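(* Let $d,N\ge 1$ be integers and let $\kappa=(\nu,P,\tilde P,U)\in\mathcal K_d$, with $p,\tilde p,\theta,\tilde\theta,x,\tilde x,\mathbb I$ and $\mathcal P(\cdot,\cdot)$ as defined in the context. For $w=(w_0,w_1,\dots,w_d)$ write $w'=(w_1,\dots,w_d)$. Then, as identities of polynomials in $x_0,\dots,x_d$, $$\frac{\tilde x^{\tilde n}}{\tilde\theta^N}=N!\sum_{n\in\mathbb I}\mathcal P(n',\tilde n')\frac{\tilde p^{\,n}}{n!}x^{n}\qquad\text{for every }\tilde n\in\mathbb I,$$ and $$\frac{x^{n}}{\theta^N}=N!\sum_{\tilde n\in\mathbb I}\mathcal P(n',\tilde n')\frac{p^{\tilde n}}{\tilde n!}\tilde x^{\tilde n}\qquad\text{for every }n\in\mathbb I.$$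
   Context: $\mathcal K_d$ is the set of 4-tuples $(\nu,P,\tilde P,U)$ where $\nu$ is a nonzero complex number and $P,\tilde P,U$ are $(d+1)\times(d+1)$ complex matrices (rows and columns indexed by $0,\dots,d$) such that: (i) $P=\mathrm{diag}(p_0,\dots,p_d)$ and $\tilde P=\mathrm{diag}(\tilde p_0,\dots,\tilde p_d)$ with $p_0=\tilde p_0=1/\nu$; (ii) $U=(u_{i,j})_{0\le i,j\le d}$ with $u_{0,j}=u_{j,0}=1$ for all $j=0,\dots,d$; (iii) $\nu PU\tilde PU^t=I_{d+1}$. Write $p=(p_0,\dots,p_d)$, $\tilde p=(\tilde p_0,\dots,\tilde p_d)$. Let $\tilde\theta\in\mathbb C$ be such that the matrix $R=\tilde\theta\tilde PU^t$ has $\det R=1$, and let $\theta=\nu/\tilde\theta$ (so $R^{-1}=\theta PU$). Let $x=(x_0,\dots,x_d)$ be commuting variables and define $\tilde x=(\tilde x_0,\dots,\tilde x_d)$ by the row-vector equation $\tilde x=xR$. Multi-index notation: for $\lambda\in\mathbb N_0^{d+1}$, $x^\lambda=\prod_{i=0}^d x_i^{\lambda_i}$, $\lambda!=\prod_{i=0}^d\lambda_i!$, $|\lambda|=\sum_{i=0}^d\lambda_i$ (similarly for $\tilde x^\lambda,p^\lambda,\tilde p^{\,\lambda}$). $\mathbb I=\{\lambda\in\mathbb N_0^{d+1}:|\lambda|=N\}$. The multivariate Krawtchouk polynomials are defined, for $m=(m_1,\dots,m_d)$ and $\tilde m=(\tilde m_1,\dots,\tilde m_d)$ in $\mathbb N_0^d$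 with $\sum m_i\le N$, $\sum\tilde m_i\le N$, by $$\mathcal P(m,\tilde m)=\sum_{A=(a_{i,j})\in\mathcal M_{d,N}}\frac{\prod_{j=1}^d(-m_j)_{\sum_{i=1}^da_{i,j}}\prod_{i=1}^d(-\tilde m_i)_{\sum_{j=1}^da_{i,j}}}{(-N)_{\sum_{i,j=1}^da_{i,j}}}\prod_{i,j=1}^d\frac{\omega_{i,j}^{a_{i,j}}}{a_{i,j}!},$$ where $\omega_{i,j}=1-u_{i,j}$, $\mathcal M_{d,N}$ is the set of $d\times d$ matrices with nonnegative integer entries whose sum is at most $N$, and $(a)_k=a(a+1)\cdots(a+k-1)$, $(a)_0=1$. *)

theory Defs
  imports
    Complex_Main
    "HOL-Library.Poly_Mapping"
    "Jordan_Normal_Form.Determinant"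
begin

text \<open>
  Complex polynomials in commuting variables \<open>x\<^sub>0, x\<^sub>1, x\<^sub>2, \<dots>\<close>: finitely supported maps from
  exponents (themselves finitely supported maps from variable indices to naturals) to
  coefficients; the ring structure is the convolution product of \<^theory>\<open>HOL-Library.Poly_Mapping\<close>.
\<close>
type_synonym cpoly = "(nat \<Rightarrow>\<^sub>0 nat) \<Rightarrow>\<^sub>0 complex"

definition const_poly :: "complex \<Rightarrow> cpoly" where
  "const_poly c = Poly_Mapping.single 0 c"

definition var_poly :: "nat \<Rightarrow> cpoly" where
  "var_poly i = Poly_Mapping.single (Poly_Mapping.single i 1) 1"

text \<open>
  A tuple indexed by \<open>0..d\<close> is a function on \<^typ>\<open>nat\<close> of which only the values on \<open>{0..d}\<close>
  are used. Multi-indices are in addition required to vanish beyond \<open>d\<close> where they are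
  summed over, so that each of them is represented by exactly one function.
\<close>
definition multi_power :: "nat \<Rightarrow> (nat \<Rightarrow> 'a::comm_monoid_mult) \<Rightarrow> (nat \<Rightarrow> nat) \<Rightarrow> 'a" where
  "multi_power d x l = (\<Prod>i=0..d. x i ^ l i)"

definition multi_fact :: "nat \<Rightarrow> (nat \<Rightarrow> nat) \<Rightarrow> nat" where
  "multi_fact d l = (\<Prod>i=0..d. fact (l i))"

definition multi_indices :: "nat \<Rightarrow> nat \<Rightarrow> (nat \<Rightarrow> nat) set" where
  "multi_indices d N = {l. (\<forall>i>d. l i = 0) \<and> (\<Sum>i=0..d. l i) = N}"

definition krawtchouk_params ::
    "nat \<Rightarrow> (complex \<times> complex mat \<times> complex mat \<times> complex mat) set" where
  "krawtchouk_params d = {(\<nu>, P, Pt, U).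
     \<nu> \<noteq> 0 \<and>
     P \<in> carrier_mat (d + 1) (d + 1) \<and>
     Pt \<in> carrier_mat (d + 1) (d + 1) \<and>
     U \<in> carrier_mat (d + 1) (d + 1) \<and>
     diagonal_mat P \<and> diagonal_mat Pt \<and>
     P $$ (0,0) = 1 / \<nu> \<and> Pt $$ (0,0) = 1 / \<nu> \<and>
     (\<forall>j\<le>d. U $$ (0,j) = 1 \<and> U $$ (j,0) = 1) \<and>
     \<nu> \<cdot>\<^sub>m (P * U * Pt * transpose_mat U) = 1\<^sub>m (d + 1)}"

text \<open>The \<open>d \<times> d\<close> matrices of naturals, with rows and columns numbered \<open>1..d\<close>.\<close>
definition nat_matrices :: "nat \<Rightarrow> nat \<Rightarrow> (nat \<Rightarrow> nat \<Rightarrow> nat) set" where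
  "nat_matrices d N = {a. (\<forall>i j. i \<notin> {1..d} \<or> j \<notin> {1..d} \<longrightarrow> a i j = 0) \<and>
     (\<Sum>i=1..d. \<Sum>j=1..d. a i j) \<le> N}"

text \<open>
  Only \<open>m 1, \<dots>, m d\<close> and \<open>mt 1, \<dots>, mt d\<close> enter the formula. Hence for a multi-index
  \<open>n = (n\<^sub>0, \<dots>, n\<^sub>d)\<close> the value at the truncation \<open>n' = (n\<^sub>1, \<dots>, n\<^sub>d)\<close> is obtained by
  passing \<open>n\<close> itself.
\<close>
definition krawtchouk ::
    "nat \<Rightarrow> nat \<Rightarrow> complex mat \<Rightarrow> (nat \<Rightarrow> nat) \<Rightarrow> (nat \<Rightarrow> nat) \<Rightarrow> complex" where
  "krawtchouk d N U m mt = (\<Sum>a\<in>nat_matrices d N.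
     ((\<Prod>j=1..d. pochhammer (- of_nat (m j)) (\<Sum>i=1..d. a i j)) *
      (\<Prod>i=1..d. pochhammer (- of_nat (mt i)) (\<Sum>j=1..d. a i j))) /
     pochhammer (- of_nat N) (\<Sum>i=1..d. \<Sum>j=1..d. a i j) *
     (\<Prod>i=1..d. \<Prod>j=1..d. (1 - U $$ (i,j)) ^ a i j / fact (a i j)))"

end

theory Submission
  imports Defs
begin

text \<open>
  After absorbing \<open>pt\<close> into the variables, the first identity expands
  \<open>\<Prod>\<^sub>j (\<Sum>\<^sub>i u\<^sub>j\<^sub>i y\<^sub>i)\<close> with multiplicities \<open>nt\<^sub>j\<close>. Put \<open>s = \<Sum>\<^sub>i y\<^sub>i\<close>. As \<open>U\<close> has ones in row and column 0,
  the factor \<open>j = 0\<close> is \<open>s\<close> and the factor \<open>j \<ge> 1\<close> is \<open>s - \<Sum>\<^sub>i\<^sub>\<ge>\<^sub>1 \<omega>\<^sub>j\<^sub>i y\<^sub>i\<close>. The multinomial theorem in each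
  of these \<open>d\<close> factors produces the sum over matrices \<open>a\<close>, with the row sums of \<open>a\<close> in Pochhammer
  symbols; expanding the remaining power of \<open>s\<close>, whose exponent is \<open>N\<close> minus the total of \<open>a\<close>, and
  shifting exponents by the column sums of \<open>a\<close> gives the other Pochhammer symbols. The second identity is the
  first one for the transposed \<open>U\<close>, because the inverse of \<open>R\<close> is \<open>\<theta> P U\<close>.
\<close>

section \<open>Multi-indices on a finite set\<close>

definition indices_on :: "'i set \<Rightarrow> nat \<Rightarrow> ('i \<Rightarrow> nat) set" where
  "indices_on S k = {l. (\<forall>i. i \<notin> S \<longrightarrow> l i = 0) \<and> sum l S = k}"

lemma multi_indices_eq_indices_on: "multi_indices d N = indices_on {0..d} N"
  by (auto simp: multi_indices_def indices_on_def)

lemma finite_zero_outside_bounded: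
  assumes "finite S"
  shows "finite {l :: 'i \<Rightarrow> nat. (\<forall>i. i \<notin> S \<longrightarrow> l i = 0) \<and> sum l S \<le> k}"
proof (rule finite_subset)
  show "{l. (\<forall>i. i \<notin> S \<longrightarrow> l i = 0) \<and> sum l S \<le> k}
      \<subseteq> {l. \<forall>i. (i \<in> S \<longrightarrow> l i \<in> {..k}) \<and> (i \<notin> S \<longrightarrow> l i = 0)}"
    using assms by (auto intro: order_trans[OF member_le_sum])
  show "finite {l. \<forall>i. (i \<in> S \<longrightarrow> l i \<in> {..k}) \<and> (i \<notin> S \<longrightarrow> l i = (0::nat))}"
    using assms by (intro finite_set_of_finite_funs) auto
qed

lemma finite_indices_on: "finite S \<Longrightarrow> finite (indices_on S k)"
  by (rule finite_subset[OF _ finite_zero_outside_bounded[of S k]]) (auto simp: indices_on_def)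

section \<open>Pochhammer symbols at negative integers\<close>

lemma pochhammer_neg_nat:
  assumes "k \<le> n"
  shows "pochhammer (- of_nat n :: 'k::field_char_0) k = (- 1) ^ k * (fact n / fact (n - k))"
proof -
  have "of_nat (n choose k) = (- 1) ^ k * pochhammer (- of_nat n :: 'k) k / fact k"
    by (simp add: binomial_gbinomial gbinomial_pochhammer)
  moreover have "of_nat (n choose k) = (fact n / (fact k * fact (n - k)) :: 'k)"
    using assms by (rule binomial_fact)
  ultimately have "(- 1) ^ k * pochhammer (- of_nat n :: 'k) k = fact n / fact (n - k)"
    by (simp add: field_simps)
  \<comment> \<open>Since \<open>(- 1) ^ k\<close> squares to 1, multiplying by it once more moves
    the sign to the right-hand side.\<close>
  then have "(- 1) ^ k * ((- 1) ^ k * pochhammer (- of_nat n :: 'k) k)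
      = (- 1) ^ k * (fact n / fact (n - k))"
    by simp
  then show ?thesis
    by (simp add: mult.assoc[symmetric] power_mult_distrib[symmetric])
qed

text \<open>One of the \<open>k\<close> factors is \<open>- n + n\<close>. This vanishing is what
  later allows summation ranges to be enlarged to all multi-indices and to all of
  \<open>nat_matrices\<close>.\<close>

lemma pochhammer_neg_nat_eq_0:
  "n < k \<Longrightarrow> pochhammer (- of_nat n :: 'k::field_char_0) k = 0"
  by (simp add: pochhammer_of_nat_eq_0_iff)

text \<open>Distributivity, with the choice functions of \<open>PiE\<close> re-encoded to be zero
  rather than \<open>undefined\<close> outside \<open>T\<close>. If \<open>f i\<close> and
  \<open>B i\<close> describe row \<open>i\<close>, the choice functions are then matrices in the
  encoding of \<open>nat_matrices\<close>.\<close>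

lemma prod_sum_zero_outside:
  fixes f :: "'i \<Rightarrow> ('j \<Rightarrow> nat) \<Rightarrow> 'a::comm_semiring_1"
  assumes "finite T" and "\<And>i. i \<in> T \<Longrightarrow> finite (B i)"
  shows "(\<Prod>i\<in>T. \<Sum>r\<in>B i. f i r) =
    (\<Sum>a\<in>{a. (\<forall>i. i \<notin> T \<longrightarrow> a i = (\<lambda>_. 0)) \<and> (\<forall>i\<in>T. a i \<in> B i)}. \<Prod>i\<in>T. f i (a i))"
proof -
  have "(\<Prod>i\<in>T. \<Sum>r\<in>B i. f i r) = (\<Sum>a\<in>Pi\<^sub>E T B. \<Prod>i\<in>T. f i (a i))"
    using assms by (rule prod_sum_PiE)
  also have "\<dots> = (\<Sum>a\<in>{a. (\<forall>i. i \<notin> T \<longrightarrow> a i = (\<lambda>_. 0)) \<and> (\<forall>i\<in>T. a i \<in> B i)}. \<Prod>i\<in>T. f i (a i))"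
    by (rule sum.reindex_bij_witness
        [where i = "\<lambda>a. restrict a T" and j = "\<lambda>g i. if i \<in> T then g i else (\<lambda>_. 0)"])
      (auto simp: fun_eq_iff restrict_def PiE_def extensional_def intro!: prod.cong)
  finally show ?thesis .
qed

section \<open>Divided powers and multinomial expansions in an algebra over a field\<close>

locale field_algebra = comm_ring_hom h
  for h :: "'k::field_char_0 \<Rightarrow> 'a::comm_ring_1"
begin

text \<open>The divided power \<open>z ^ k / k!\<close>. The inverse factorial is taken in the field
  and mapped by \<open>h\<close>, as the algebra itself need not have division. In this
  normalisation the binomial and multinomial theorems carry no coefficients.\<close>

definition divpow :: "nat \<Rightarrow> 'a \<Rightarrow> 'a" where
  "divpow k z = h (1 / fact k) * z ^ k"

lemma hom_fact_cancel: "h (fact k) * (h (1 / fact k) * z) = z"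
  by (simp add: mult.assoc[symmetric] hom_mult[symmetric])

lemma power_eq_divpow: "z ^ k = h (fact k) * divpow k z"
  by (simp add: divpow_def hom_fact_cancel)

text \<open>The binomial coefficient is \<open>k! / (i! (k - i)!)\<close>, so dividing the binomial
  theorem by \<open>k!\<close> leaves exactly the two inverse factorials.\<close>

lemma divpow_add: "divpow k (a + b) = (\<Sum>i\<le>k. divpow i a * divpow (k - i) b)"
proof -
  have "h (1 / fact k) * (of_nat (k choose i) * a ^ i * b ^ (k - i)) =
      divpow i a * divpow (k - i) b" if "i \<le> k" for i
  proof -
    have "1 / fact k * of_nat (k choose i) = (1 / fact i * (1 / fact (k - i)) :: 'k)"
      using that by (simp add: binomial_fact)
    then have "h (1 / fact k) * of_nat (k choose i) = h (1 / fact i) * h (1 / fact (k - i))"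
      by (metis hom_mult hom_of_nat)
    then show ?thesis
      by (simp add: divpow_def algebra_simps) (metis mult.assoc mult.commute)
  qed
  then show ?thesis
    unfolding divpow_def[of k] binomial_ring sum_distrib_left by (intro sum.cong) auto
qed

text \<open>The multinomial theorem, by induction on \<open>S\<close>: \<open>divpow_add\<close>
  splits off the exponent \<open>j\<close> of the new element, and the induction hypothesis expands
  the rest with exponent \<open>k - j\<close>.\<close>

lemma divpow_sum:
  assumes "finite S"
  shows "divpow k (\<Sum>i\<in>S. y i) = (\<Sum>l\<in>indices_on S k. \<Prod>i\<in>S. divpow (l i) (y i))"
  using assms
proof (induction S arbitrary: k)
  case empty
  show ?case
  proof (cases "k = 0")
    case True
    then have "indices_on {} k = {\<lambda>_ :: 'b. 0 :: nat}"
      by (auto simp: indices_on_def)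
    then show ?thesis
      using True by (simp add: divpow_def)
  next
    case False
    then have "indices_on {} k = ({} :: ('b \<Rightarrow> nat) set)"
      by (auto simp: indices_on_def)
    then show ?thesis
      using False by (simp add: divpow_def zero_power)
  qed
next
  case (insert b S)
  have upd: "(\<Sum>i\<in>S. if i = b then c else g i) = sum g S"
      "(\<Sum>i\<in>S. (g(b := c)) i) = sum g S" for g :: "'b \<Rightarrow> nat" and c
    using insert.hyps by (auto intro!: sum.cong)
  have "divpow k (sum y (insert b S)) =
      (\<Sum>j\<le>k. \<Sum>l\<in>indices_on S (k - j). divpow j (y b) * (\<Prod>i\<in>S. divpow (l i) (y i)))"
    using insert by (simp add: divpow_add sum_distrib_left)
  also have "\<dots> = (\<Sum>(j, l)\<in>(SIGMA j:{..k}. indices_on S (k - j)).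
      divpow j (y b) * (\<Prod>i\<in>S. divpow (l i) (y i)))"
    using insert.hyps by (intro sum.Sigma) (auto simp: finite_indices_on)
  \<comment> \<open>A multi-index on \<open>insert b S\<close> is the pair of its value at
    \<open>b\<close> and the rest, which is reset to 0 at \<open>b\<close> because it must vanish
    outside \<open>S\<close>.\<close>
  also have "\<dots> = (\<Sum>l\<in>indices_on (insert b S) k. \<Prod>i\<in>insert b S. divpow (l i) (y i))"
  proof (rule sum.reindex_bij_witness
      [where i = "\<lambda>l. (l b, l(b := 0))" and j = "\<lambda>(j, l). l(b := j)"], goal_cases)
    case (1 q)
    then show ?case using insert.hyps by (auto simp: indices_on_def fun_eq_iff)
  next
    case (2 q)
    then show ?case using insert.hyps by (auto simp: indices_on_def upd)
  next
    case (3 l)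
    then show ?case by (auto simp: indices_on_def fun_eq_iff)
  next
    case (4 l)
    then show ?case using insert.hyps by (auto simp: indices_on_def upd)
  next
    case (5 q)
    then show ?case using insert.hyps by (auto intro!: arg_cong2[where f = "(*)"] prod.cong)
  qed
  finally show ?case .
qed

text \<open>This expands a single factor with \<open>j \<ge> 1\<close>, keeping \<open>s\<close>
  unexpanded. In degree \<open>k\<close>, the sign \<open>(- 1) ^ k\<close> from the negated weights
  and the quotient \<open>m! / (m - k)!\<close> combine to the Pochhammer symbol of
  \<open>- m\<close>.\<close>

lemma power_diff_sum_expansion:
  assumes "finite S"
  shows "(s - (\<Sum>i\<in>S. h (w i) * y i)) ^ m =
    (\<Sum>r\<in>{r. (\<forall>i. i \<notin> S \<longrightarrow> r i = 0) \<and> sum r S \<le> m}.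
      h (pochhammer (- of_nat m) (sum r S) * (\<Prod>i\<in>S. w i ^ r i / fact (r i))) *
      (s ^ (m - sum r S) * (\<Prod>i\<in>S. y i ^ r i)))"
    (is "_ = sum ?g ?B")
proof -
  have "s - (\<Sum>i\<in>S. h (w i) * y i) = (\<Sum>i\<in>S. h (- w i) * y i) + s"
    by (simp add: hom_uminus sum_negf)
  then have "(s - (\<Sum>i\<in>S. h (w i) * y i)) ^ m =
      (\<Sum>k\<le>m. \<Sum>r\<in>indices_on S k.
        h (fact m) * ((\<Prod>i\<in>S. divpow (r i) (h (- w i) * y i)) * divpow (m - k) s))"
    using assms
    by (simp only: power_eq_divpow[of _ m] divpow_add divpow_sum sum_distrib_left sum_distrib_right)
  also have "\<dots> = (\<Sum>k\<le>m. \<Sum>r\<in>indices_on S k. ?g r)"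
  proof (intro sum.cong refl)
    fix k r assume k: "k \<in> {..m}" and "r \<in> indices_on S k"
    then have r: "sum r S = k" by (simp add: indices_on_def)
    have "(\<Prod>i\<in>S. divpow (r i) (h (- w i) * y i)) =
        (\<Prod>i\<in>S. h ((- 1) ^ r i * (w i ^ r i / fact (r i))) * y i ^ r i)"
    proof (intro prod.cong refl)
      fix i
      have "1 / fact (r i) * (- w i) ^ r i = (- 1) ^ r i * (w i ^ r i / fact (r i))"
        by (subst power_minus) simp
      then have "h (1 / fact (r i)) * h (- w i) ^ r i = h ((- 1) ^ r i * (w i ^ r i / fact (r i)))"
        by (metis hom_mult hom_power)
      then show "divpow (r i) (h (- w i) * y i) =
          h ((- 1) ^ r i * (w i ^ r i / fact (r i))) * y i ^ r i"
        by (simp only: divpow_def power_mult_distrib mult.assoc[symmetric])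
    qed
    also have "\<dots> = h ((- 1) ^ k * (\<Prod>i\<in>S. w i ^ r i / fact (r i))) * (\<Prod>i\<in>S. y i ^ r i)"
      by (simp only: prod.distrib hom_prod[symmetric] power_sum[symmetric] r)
    finally have eq: "(\<Prod>i\<in>S. divpow (r i) (h (- w i) * y i)) = \<dots>" .
    have "pochhammer (- of_nat m) (sum r S) * (\<Prod>i\<in>S. w i ^ r i / fact (r i)) =
        fact m * (((- 1) ^ k * (\<Prod>i\<in>S. w i ^ r i / fact (r i))) * (1 / fact (m - k)))"
      using k by (simp add: pochhammer_neg_nat r)
    then show "h (fact m) * ((\<Prod>i\<in>S. divpow (r i) (h (- w i) * y i)) * divpow (m - k) s) = ?g r"
      unfolding eq by (simp only: divpow_def r hom_mult ac_simps)
  qed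
  \<comment> \<open>The degree \<open>k\<close> is determined by \<open>r\<close>, so the double sum
    is the sum over \<open>?B\<close> grouped by the total of \<open>r\<close>.\<close>
  also have "\<dots> = (\<Sum>k\<in>{..m}. sum ?g {r. r \<in> ?B \<and> sum r S = k})"
    by (intro sum.cong arg_cong2[where f = sum] refl) (auto simp: indices_on_def)
  also have "\<dots> = sum ?g ?B"
    by (rule sum.group) (use finite_zero_outside_bounded[OF assms, of m] in auto)
  finally show ?thesis .
qed

text \<open>Expand the power by the multinomial theorem and substitute \<open>n = l + c\<close>. Up
  to sign, \<open>n i! / (n i - c i)!\<close> is the Pochhammer symbol in the numerator and
  \<open>N! / (N - k)!\<close> the one in the denominator; both carry the total sign
  \<open>(- 1) ^ k\<close>, which cancels.\<close>

lemma sum_power_times_monomial: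
  assumes S: "finite S" and c: "c \<in> indices_on S k" and k: "k \<le> N"
  shows "(\<Sum>i\<in>S. y i) ^ (N - k) * (\<Prod>i\<in>S. y i ^ c i) =
    (\<Sum>n\<in>indices_on S N.
      h (fact N / pochhammer (- of_nat N) k * (\<Prod>i\<in>S. pochhammer (- of_nat (n i)) (c i) / fact (n i))) *
      (\<Prod>i\<in>S. y i ^ n i))"
    (is "_ = sum ?f _")
proof -
  have csum: "sum c S = k" and c0: "\<And>i. i \<notin> S \<Longrightarrow> c i = 0"
    using c by (auto simp: indices_on_def)
  \<comment> \<open>\<open>?J\<close> is the image of the shift by \<open>c\<close>. Any other
    multi-index has some \<open>n i < c i\<close>, so its Pochhammer product is zero and it can be
    added to the sum.\<close>
  let ?J = "{n \<in> indices_on S N. \<forall>i\<in>S. c i \<le> n i}"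
  have "(\<Sum>i\<in>S. y i) ^ (N - k) * (\<Prod>i\<in>S. y i ^ c i) =
      (\<Sum>l\<in>indices_on S (N - k).
        h (fact (N - k)) * (\<Prod>i\<in>S. divpow (l i) (y i)) * (\<Prod>i\<in>S. y i ^ c i))"
    using S by (simp only: power_eq_divpow[of "sum y S"] divpow_sum sum_distrib_left sum_distrib_right)
  also have "\<dots> = sum ?f ?J"
  proof (rule sum.reindex_bij_witness
      [where i = "\<lambda>n i. n i - c i" and j = "\<lambda>l i. l i + c i"], goal_cases)
    case (1 l)
    then show ?case by simp
  next
    case (2 l)
    then show ?case using csum c0 k by (auto simp: indices_on_def sum.distrib)
  next
    case (3 n)
    \<comment> \<open>Truncated subtraction is undone because \<open>c i \<le> n i\<close> on
      \<open>S\<close> and \<open>c\<close> vanishes off \<open>S\<close>.\<close>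
    then have "n i - c i + c i = n i" for i
      using c0 by (cases "i \<in> S") auto
    then show ?case by (simp add: fun_eq_iff)
  next
    case (4 n)
    then have "(\<Sum>i\<in>S. n i - c i) = N - k"
      using csum by (subst sum_subtractf_nat) (auto simp: indices_on_def)
    then show ?case using 4 by (auto simp: indices_on_def)
  next
    case (5 l)
    have "(\<Prod>i\<in>S. pochhammer (- of_nat (l i + c i)) (c i) / fact (l i + c i)) =
        (\<Prod>i\<in>S. (- 1) ^ c i * (1 / fact (l i)) :: 'k)"
      by (intro prod.cong refl) (simp add: pochhammer_neg_nat del: of_nat_add)
    also have "\<dots> = (- 1) ^ k * (\<Prod>i\<in>S. 1 / fact (l i))"
      by (simp only: prod.distrib power_sum[symmetric] csum)
    finally have "fact N / pochhammer (- of_nat N) k *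
          (\<Prod>i\<in>S. pochhammer (- of_nat (l i + c i)) (c i) / fact (l i + c i)) =
        (fact (N - k) * (\<Prod>i\<in>S. 1 / fact (l i)) :: 'k)"
      using k by (simp add: pochhammer_neg_nat)
    then show ?case
      by (simp only: divpow_def prod.distrib power_add hom_mult hom_prod ac_simps)
  qed
  also have "\<dots> = sum ?f (indices_on S N)"
  proof (rule sum.mono_neutral_left)
    show "finite (indices_on S N)" using S by (rule finite_indices_on)
    show "\<forall>n\<in>indices_on S N - ?J. ?f n = 0"
    proof
      fix n assume "n \<in> indices_on S N - ?J"
      then obtain i where i: "i \<in> S" "n i < c i" by (auto simp: not_le)
      then have "(\<Prod>i\<in>S. pochhammer (- of_nat (n i) :: 'k) (c i) / fact (n i)) = 0"
        using S by (intro prod_zero) (auto intro!: bexI[of _ i] simp: pochhammer_neg_nat_eq_0)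
      then show "?f n = 0" by simp
    qed
  qed auto
  finally show ?thesis .
qed

end

section \<open>Symmetry under transposition and the generating identity\<close>

lemma krawtchouk_transpose:
  assumes "U \<in> carrier_mat (d + 1) (d + 1)"
  shows "krawtchouk d N (transpose_mat U) n m = krawtchouk d N U m n"
  unfolding krawtchouk_def
\<comment> \<open>Transposing the summation matrix exchanges its row sums with its column sums,
  hence the two arguments, and preserves its total.\<close>
proof (rule sum.reindex_bij_witness
    [where i = "\<lambda>a i j. a j i" and j = "\<lambda>a i j. a j i"], goal_cases)
  case (2 a)
  then show ?case by (auto simp: nat_matrices_def intro: order_trans[OF eq_refl[OF sum.swap]])
next
  case (4 a)
  then show ?case by (auto simp: nat_matrices_def intro: order_trans[OF eq_refl[OF sum.swap]])
next
  case (5 a)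
  have "(\<Prod>i=1..d. \<Prod>j=1..d. (1 - transpose_mat U $$ (i, j)) ^ a i j / fact (a i j)) =
      (\<Prod>i=1..d. \<Prod>j=1..d. (1 - U $$ (j, i)) ^ a i j / fact (a i j))"
    using assms by (intro prod.cong refl) simp
  also have "\<dots> = (\<Prod>j=1..d. \<Prod>i=1..d. (1 - U $$ (j, i)) ^ a i j / fact (a i j))"
    by (rule prod.swap)
  finally have *: "(\<Prod>i=1..d. \<Prod>j=1..d. (1 - transpose_mat U $$ (i, j)) ^ a i j / fact (a i j)) = \<dots>" .
  show ?case
    unfolding * by (subst sum.swap) (simp add: mult.commute)
qed auto

text \<open>The elements \<open>y\<close> are arbitrary so that the identity serves twice: with
  \<open>pt i\<close> times \<open>x i\<close> for \<open>U\<close>, and with \<open>p i\<close>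
  times \<open>xt i\<close> for the transpose of \<open>U\<close>.\<close>

lemma krawtchouk_generating_identity:
  fixes h :: "complex \<Rightarrow> 'a::comm_ring_1"
  assumes "field_algebra h"
    and U0: "\<And>j. j \<le> d \<Longrightarrow> U $$ (0, j) = 1" "\<And>j. j \<le> d \<Longrightarrow> U $$ (j, 0) = 1"
    and nt: "nt \<in> multi_indices d N"
  shows "(\<Prod>j=0..d. (\<Sum>i=0..d. h (U $$ (j, i)) * y i) ^ nt j) =
    h (fact N) * (\<Sum>n\<in>multi_indices d N.
      h (krawtchouk d N U n nt / of_nat (multi_fact d n)) * multi_power d y n)"
proof -
  interpret field_algebra h by fact
  define s where "s = (\<Sum>i=0..d. y i)"
  define w where "w j i = 1 - U $$ (j, i)" for j i
  have ntN: "nt 0 + (\<Sum>j=1..d. nt j) = N"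
    using nt by (simp add: multi_indices_def sum.atLeast_Suc_atMost)
  have row: "(\<Sum>i=0..d. h (U $$ (j, i)) * y i) = s - (\<Sum>i=1..d. h (w j i) * y i)"
    if "j \<le> d" for j
  proof -
    have "(\<Sum>i=0..d. h (U $$ (j, i)) * y i) = s - (\<Sum>i=0..d. h (w j i) * y i)"
      by (simp add: s_def w_def hom_minus sum_subtractf[symmetric] algebra_simps)
    \<comment> \<open>Column 0 of \<open>U\<close> consists of ones, so the weight
      \<open>w j 0\<close> is zero.\<close>
    also have "(\<Sum>i=0..d. h (w j i) * y i) = (\<Sum>i=1..d. h (w j i) * y i)"
      using U0(2)[OF that] by (subst sum.atLeast_Suc_atMost) (simp_all add: w_def)
    finally show ?thesis .
  qed
  have row0: "(\<Sum>i=0..d. h (U $$ (0, i)) * y i) = s"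
    using U0(1) by (simp add: s_def)
  \<comment> \<open>\<open>M\<close> is the range that multiplying out the rows produces: row
    \<open>i\<close> of the matrix has sum at most \<open>nt i\<close>. It is later enlarged to
    \<open>nat_matrices d N\<close>.\<close>
  define B where "B m = {r :: nat \<Rightarrow> nat. (\<forall>i. i \<notin> {1..d} \<longrightarrow> r i = 0) \<and> sum r {1..d} \<le> m}" for m
  define M where "M = {a. (\<forall>i. i \<notin> {1..d} \<longrightarrow> a i = (\<lambda>_. 0)) \<and> (\<forall>i\<in>{1..d}. a i \<in> B (nt i))}"
  \<comment> \<open>\<open>C a\<close> holds the row Pochhammer symbols and the weights; the column
    symbols and the denominator arise only when the power of \<open>s\<close> is expanded.\<close>
  define C where "C a = (\<Prod>i=1..d. pochhammer (- of_nat (nt i)) (sum (a i) {1..d})) *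
      (\<Prod>i=1..d. \<Prod>j=1..d. w i j ^ a i j / fact (a i j))" for a :: "nat \<Rightarrow> nat \<Rightarrow> nat"
  let ?row = "\<lambda>j r. h (pochhammer (- of_nat (nt j)) (sum r {1..d}) * (\<Prod>i=1..d. w j i ^ r i / fact (r i))) *
      (s ^ (nt j - sum r {1..d}) * (\<Prod>i=1..d. y i ^ r i))"
  let ?tot = "\<lambda>a :: nat \<Rightarrow> nat \<Rightarrow> nat. \<Sum>i=1..d. \<Sum>j=1..d. a i j"
  let ?col = "\<lambda>(a :: nat \<Rightarrow> nat \<Rightarrow> nat) j. \<Sum>i=1..d. a i j"
  have finB: "finite (B m)" for m
    unfolding B_def by (rule finite_zero_outside_bounded) simp
  have Mtot: "?tot a \<le> (\<Sum>j=1..d. nt j)" if "a \<in> M" for a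
    using that by (intro sum_mono) (auto simp: M_def B_def)
  have finM: "finite (nat_matrices d N)"
  proof (rule finite_subset)
    show "nat_matrices d N \<subseteq> {a. \<forall>i. (i \<in> {1..d} \<longrightarrow> a i \<in> B N) \<and> (i \<notin> {1..d} \<longrightarrow> a i = (\<lambda>_. 0))}"
    proof
      fix a assume a: "a \<in> nat_matrices d N"
      have "sum (a i) {1..d} \<le> N" if "i \<in> {1..d}" for i
      proof -
        have "sum (a i) {1..d} \<le> ?tot a" using that by (intro member_le_sum) auto
        also have "\<dots> \<le> N" using a by (simp add: nat_matrices_def)
        finally show ?thesis .
      qed
      then show "a \<in> {a. \<forall>i. (i \<in> {1..d} \<longrightarrow> a i \<in> B N) \<and> (i \<notin> {1..d} \<longrightarrow> a i = (\<lambda>_. 0))}"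
        using a by (auto simp: nat_matrices_def B_def fun_eq_iff)
    qed
    show "finite {a. \<forall>i. (i \<in> {1..d} \<longrightarrow> a i \<in> B N) \<and> (i \<notin> {1..d} \<longrightarrow> a i = (\<lambda>_. 0))}"
      using finB by (intro finite_set_of_finite_funs) auto
  qed
  have MM: "M \<subseteq> nat_matrices d N"
  proof
    fix a assume a: "a \<in> M"
    have "?tot a \<le> N" using Mtot[OF a] ntN by linarith
    then show "a \<in> nat_matrices d N"
      using a by (auto simp: M_def B_def nat_matrices_def)
  qed
  have "(\<Prod>j=0..d. (\<Sum>i=0..d. h (U $$ (j, i)) * y i) ^ nt j) =
      s ^ nt 0 * (\<Prod>j=1..d. (\<Sum>i=0..d. h (U $$ (j, i)) * y i) ^ nt j)"
    by (subst prod.atLeast_Suc_atMost) (simp_all add: row0)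
  also have "(\<Prod>j=1..d. (\<Sum>i=0..d. h (U $$ (j, i)) * y i) ^ nt j) =
      (\<Prod>j=1..d. (s - (\<Sum>i=1..d. h (w j i) * y i)) ^ nt j)"
    by (intro prod.cong arg_cong2[where f = "(^)"] refl row) simp
  also have "(\<Prod>j=1..d. (s - (\<Sum>i=1..d. h (w j i) * y i)) ^ nt j) =
      (\<Sum>a\<in>M. \<Prod>j=1..d. ?row j (a j))"
    unfolding M_def power_diff_sum_expansion[OF finite_atLeastAtMost] B_def[symmetric]
    by (rule prod_sum_zero_outside) (simp_all add: finB)
  also have "s ^ nt 0 * \<dots> = (\<Sum>a\<in>M. h (C a) * (s ^ (N - ?tot a) * (\<Prod>j=0..d. y j ^ ?col a j)))"
    unfolding sum_distrib_left
  proof (intro sum.cong refl)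
    fix a assume a: "a \<in> M"
    have "?tot a \<le> (\<Sum>j=1..d. nt j)" by (rule Mtot[OF a])
    \<comment> \<open>On \<open>M\<close> no row sum exceeds \<open>nt j\<close>, so the truncated
      differences are exact and the leftover exponents of \<open>s\<close> add up to
      \<open>N - ?tot a\<close>.\<close>
    moreover have "(\<Sum>j=1..d. nt j - sum (a j) {1..d}) = (\<Sum>j=1..d. nt j) - ?tot a"
      using a by (intro sum_subtractf_nat) (auto simp: M_def B_def)
    ultimately have exp: "N - ?tot a = nt 0 + (\<Sum>j=1..d. nt j - sum (a j) {1..d})"
      using ntN by linarith
    \<comment> \<open>As column 0 of \<open>a\<close> is zero, the monomial can be written over
      \<open>0..d\<close>, the index set used when \<open>s\<close> is expanded.\<close>
    have "?col a 0 = 0"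
      using a by (auto simp: M_def B_def)
    then have "(\<Prod>j=0..d. y j ^ ?col a j) = (\<Prod>i=1..d. \<Prod>j=1..d. y i ^ a j i)"
      by (simp add: prod.atLeast_Suc_atMost power_sum)
    also have "\<dots> = (\<Prod>j=1..d. \<Prod>i=1..d. y i ^ a j i)"
      by (rule prod.swap)
    finally have mono: "(\<Prod>j=0..d. y j ^ ?col a j) = (\<Prod>j=1..d. \<Prod>i=1..d. y i ^ a j i)" .
    show "s ^ nt 0 * (\<Prod>j=1..d. ?row j (a j)) =
      h (C a) * (s ^ (N - ?tot a) * (\<Prod>j=0..d. y j ^ ?col a j))"
      unfolding exp mono C_def by (simp only: power_add power_sum prod.distrib hom_mult hom_prod ac_simps)
  qed
  \<comment> \<open>A matrix outside \<open>M\<close> has a row sum above some \<open>nt i\<close>,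
    and then \<open>C a\<close> vanishes.\<close>
  also have "\<dots> = (\<Sum>a\<in>nat_matrices d N. h (C a) * (s ^ (N - ?tot a) * (\<Prod>j=0..d. y j ^ ?col a j)))"
  proof (rule sum.mono_neutral_left[OF finM MM], rule ballI)
    fix a assume a: "a \<in> nat_matrices d N - M"
    then obtain i where i: "i \<in> {1..d}" "nt i < sum (a i) {1..d}"
      by (auto simp: nat_matrices_def M_def B_def fun_eq_iff not_le)
    then have "(\<Prod>i=1..d. pochhammer (- of_nat (nt i) :: complex) (sum (a i) {1..d})) = 0"
      by (intro prod_zero) (auto intro!: bexI[of _ i] simp: pochhammer_neg_nat_eq_0)
    then have "C a = 0"
      by (simp only: C_def mult_zero_left)
    then show "h (C a) * (s ^ (N - ?tot a) * (\<Prod>j=0..d. y j ^ ?col a j)) = 0"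
      by (simp only: hom_zero mult_zero_left)
  qed
  also have "\<dots> = (\<Sum>a\<in>nat_matrices d N. \<Sum>n\<in>multi_indices d N.
      h (fact N * (((\<Prod>j=1..d. pochhammer (- of_nat (n j)) (?col a j)) *
          (\<Prod>i=1..d. pochhammer (- of_nat (nt i)) (sum (a i) {1..d}))) /
          pochhammer (- of_nat N) (?tot a) *
          (\<Prod>i=1..d. \<Prod>j=1..d. w i j ^ a i j / fact (a i j)) / of_nat (multi_fact d n))) *
      multi_power d y n)"
  proof (intro sum.cong refl)
    fix a assume a: "a \<in> nat_matrices d N"
    have col0: "?col a 0 = 0"
      using a by (auto simp: nat_matrices_def)
    have "sum (?col a) {0..d} = sum (?col a) {1..d}"
      using col0 by (simp add: sum.atLeast_Suc_atMost)
    also have "\<dots> = ?tot a"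
      by (rule sum.swap)
    finally have "?col a \<in> indices_on {0..d} (?tot a)"
      using a by (auto simp: indices_on_def nat_matrices_def)
    moreover have "?tot a \<le> N"
      using a by (auto simp: nat_matrices_def)
    \<comment> \<open>With the column sums of \<open>a\<close> as the shift, the expansion supplies
      the factors missing from \<open>C a\<close> in the Krawtchouk summand.\<close>
    ultimately have expand: "s ^ (N - ?tot a) * (\<Prod>j=0..d. y j ^ ?col a j) =
      (\<Sum>n\<in>multi_indices d N. h (fact N / pochhammer (- of_nat N) (?tot a) *
        (\<Prod>j=0..d. pochhammer (- of_nat (n j)) (?col a j) / fact (n j))) * multi_power d y n)"
      unfolding s_def multi_power_def multi_indices_eq_indices_on
      by (intro sum_power_times_monomial) auto
    have coeff: "C a * (fact N / pochhammer (- of_nat N) (?tot a) *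
        (\<Prod>j=0..d. pochhammer (- of_nat (n j)) (?col a j) / fact (n j))) =
      fact N * (((\<Prod>j=1..d. pochhammer (- of_nat (n j)) (?col a j)) *
          (\<Prod>i=1..d. pochhammer (- of_nat (nt i)) (sum (a i) {1..d}))) /
          pochhammer (- of_nat N) (?tot a) *
          (\<Prod>i=1..d. \<Prod>j=1..d. w i j ^ a i j / fact (a i j)) / of_nat (multi_fact d n))" for n
    proof -
      have "(\<Prod>j=0..d. pochhammer (- of_nat (n j)) (?col a j) / fact (n j)) =
          (\<Prod>j=1..d. pochhammer (- of_nat (n j)) (?col a j)) / (of_nat (multi_fact d n) :: complex)"
        unfolding prod_dividef multi_fact_def
        using col0 by (subst prod.atLeast_Suc_atMost) simp_all
      moreover have "(u * v) * (f / q * (u' / m)) = f * ((u' * u) / q * v / m)"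
        for u v f q u' m :: complex
        by simp
      ultimately show ?thesis
        unfolding C_def by (simp only:)
    qed
    have hom_combine: "h u * (h v * z) = h v' * z" if "u * v = v'" for u v v' z
      using that by (simp add: mult.assoc[symmetric] hom_mult[symmetric])
    show "h (C a) * (s ^ (N - ?tot a) * (\<Prod>j=0..d. y j ^ ?col a j)) =
      (\<Sum>n\<in>multi_indices d N.
      h (fact N * (((\<Prod>j=1..d. pochhammer (- of_nat (n j)) (?col a j)) *
          (\<Prod>i=1..d. pochhammer (- of_nat (nt i)) (sum (a i) {1..d}))) /
          pochhammer (- of_nat N) (?tot a) *
          (\<Prod>i=1..d. \<Prod>j=1..d. w i j ^ a i j / fact (a i j)) / of_nat (multi_fact d n))) *
      multi_power d y n)"
      unfolding expand sum_distrib_left by (intro sum.cong refl hom_combine coeff)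
  qed
  also have "\<dots> = h (fact N) * (\<Sum>n\<in>multi_indices d N.
      h (krawtchouk d N U n nt / of_nat (multi_fact d n)) * multi_power d y n)"
    unfolding krawtchouk_def sum_divide_distrib w_def hom_sum hom_mult[of "fact N"] sum_distrib_left sum_distrib_right
    by (subst sum.swap) (simp only: mult.assoc)
  finally show ?thesis .
qed

section \<open>The two polynomial identities\<close>

lemma const_poly_field_algebra: "field_algebra const_poly"
  by unfold_locales
    (simp_all add: const_poly_def single_zero single_one single_add mult_single flip: single_diff)

theorem theorem5p1:
  fixes d N :: nat
    and \<nu> \<theta> \<theta>t :: complex
    and P Pt U R :: "complex mat"
    and p pt :: "nat \<Rightarrow> complex"
    and x xt :: "nat \<Rightarrow> cpoly"
  assumes "d \<ge> 1" and "N \<ge> 1"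
    and "(\<nu>, P, Pt, U) \<in> krawtchouk_params d"
    and "\<And>i. i \<le> d \<Longrightarrow> p i = P $$ (i,i)"
    and "\<And>i. i \<le> d \<Longrightarrow> pt i = Pt $$ (i,i)"
    and "R = \<theta>t \<cdot>\<^sub>m (Pt * transpose_mat U)"
    and "det R = 1"
    and "\<theta> = \<nu> / \<theta>t"
    and "\<And>i. i \<le> d \<Longrightarrow> x i = var_poly i"
    and "\<And>j. j \<le> d \<Longrightarrow> xt j = (\<Sum>i=0..d. x i * const_poly (R $$ (i,j)))"
  shows "(\<forall>nt \<in> multi_indices d N.
            const_poly (1 / \<theta>t ^ N) * multi_power d xt nt =
            const_poly (fact N) *
              (\<Sum>n\<in>multi_indices d N.
                 const_poly (krawtchouk d N U n nt *
                   (multi_power d pt n / of_nat (multi_fact d n))) *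
                 multi_power d x n))
       \<and> (\<forall>n \<in> multi_indices d N.
            const_poly (1 / \<theta> ^ N) * multi_power d x n =
            const_poly (fact N) *
              (\<Sum>nt\<in>multi_indices d N.
                 const_poly (krawtchouk d N U n nt *
                   (multi_power d p nt / of_nat (multi_fact d nt))) *
                 multi_power d xt nt))"
proof -
  interpret field_algebra const_poly by (rule const_poly_field_algebra)
  have carr [simp]: "P \<in> carrier_mat (d + 1) (d + 1)" "Pt \<in> carrier_mat (d + 1) (d + 1)"
      "U \<in> carrier_mat (d + 1) (d + 1)"
    and diag: "diagonal_mat P" "diagonal_mat Pt" and nu: "\<nu> \<noteq> 0"
    and U0: "\<And>j. j \<le> d \<Longrightarrow> U $$ (0, j) = 1" "\<And>j. j \<le> d \<Longrightarrow> U $$ (j, 0) = 1"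
    and inv: "\<nu> \<cdot>\<^sub>m (P * U * Pt * transpose_mat U) = 1\<^sub>m (d + 1)"
    using assms(3) by (auto simp: krawtchouk_params_def)
  have dims: "dim_row P = d + 1" "dim_col P = d + 1" "dim_row Pt = d + 1" "dim_col Pt = d + 1"
      "dim_row U = d + 1" "dim_col U = d + 1"
    using carr by auto
  have tht: "\<theta>t \<noteq> 0"
  proof
    assume "\<theta>t = 0"
    \<comment> \<open>The exponent \<open>d + 1\<close> is positive, so a zero scalar would force
      \<open>det R = 0\<close>.\<close>
    then have "det R = 0 ^ (d + 1) * det (Pt * transpose_mat U)"
      using assms(6) by (simp add: det_smult dims)
    then show False using assms(7) by simp
  qed
  have th: "\<theta> \<noteq> 0" "\<theta> * \<theta>t = \<nu>" using assms(8) tht nu by auto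
  have diag_mult: "(D * A) $$ (i, j) = D $$ (i, i) * A $$ (i, j)"
    if "diagonal_mat D" "D \<in> carrier_mat (d + 1) (d + 1)" "A \<in> carrier_mat (d + 1) (d + 1)"
      "i \<le> d" "j \<le> d" for D A :: "complex mat" and i j
  proof -
    have "(D * A) $$ (i, j) = (\<Sum>k=0..<d + 1. D $$ (i, k) * A $$ (k, j))"
      using that by (simp add: scalar_prod_def)
    also have "\<dots> = (\<Sum>k\<in>{i}. D $$ (i, k) * A $$ (k, j))"
      using that by (intro sum.mono_neutral_right) (auto simp: diagonal_mat_def)
    finally show ?thesis by simp
  qed
  have R: "R $$ (i, j) = \<theta>t * (pt i * U $$ (j, i))" if "i \<le> d" "j \<le> d" for i j
  proof -
    have "(Pt * transpose_mat U) $$ (i, j) = Pt $$ (i, i) * transpose_mat U $$ (i, j)"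
      using that diag carr by (intro diag_mult) auto
    then show ?thesis
      using that by (simp add: assms(5,6) dims del: index_mult_mat(1))
  qed
  \<comment> \<open>\<open>Q\<close> is the inverse of \<open>R\<close>. Condition (iii) yields
    \<open>Q * R = 1\<close>; recovering \<open>x\<close> from \<open>xt\<close> takes the other
    order, which holds for square matrices.\<close>
  define Q where "Q = \<theta> \<cdot>\<^sub>m (P * U)"
  have Qc: "Q \<in> carrier_mat (d + 1) (d + 1)" and Rc: "R \<in> carrier_mat (d + 1) (d + 1)"
    by (auto simp: Q_def assms(6) dims)
  have Q: "Q $$ (i, j) = \<theta> * (p i * U $$ (i, j))" if "i \<le> d" "j \<le> d" for i j
  proof -
    have "(P * U) $$ (i, j) = P $$ (i, i) * U $$ (i, j)"
      using that diag carr by (intro diag_mult) auto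
    then show ?thesis
      using that by (simp add: assms(4) Q_def dims del: index_mult_mat(1))
  qed
  have "Q * R = 1\<^sub>m (d + 1)"
  proof -
    have PU: "P * U \<in> carrier_mat (d + 1) (d + 1)"
      by (rule mult_carrier_mat[OF carr(1,3)])
    have Ut: "transpose_mat U \<in> carrier_mat (d + 1) (d + 1)"
      by (simp only: transpose_carrier_mat carr)
    have PtUt: "Pt * transpose_mat U \<in> carrier_mat (d + 1) (d + 1)"
      by (rule mult_carrier_mat[OF carr(2) Ut])
    have smult_smult: "a \<cdot>\<^sub>m (b \<cdot>\<^sub>m A) = (a * b) \<cdot>\<^sub>m A" for a b and A :: "complex mat"
      by (intro eq_matI) auto
    have "Q * R = (\<theta> * \<theta>t) \<cdot>\<^sub>m (P * U * (Pt * transpose_mat U))"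
      unfolding Q_def assms(6) mult_smult_assoc_mat[OF PU smult_carrier_mat[OF PtUt]]
        mult_smult_distrib[OF PU PtUt] smult_smult ..
    also have "\<dots> = \<nu> \<cdot>\<^sub>m (P * U * Pt * transpose_mat U)"
      unfolding th(2) assoc_mult_mat[OF PU carr(2) Ut] ..
    finally show ?thesis
      unfolding inv .
  qed
  then have RQ: "R * Q = 1\<^sub>m (d + 1)"
    by (rule mat_mult_left_right_inverse[OF Qc Rc])
  have RQ_entry: "(\<Sum>j=0..d. R $$ (i, j) * Q $$ (j, k)) = (if i = k then 1 else 0)"
    if "i \<le> d" "k \<le> d" for i k
  proof -
    have "(R * Q) $$ (i, k) = (\<Sum>j=0..<d + 1. R $$ (i, j) * Q $$ (j, k))"
      using that Rc Qc by (simp add: scalar_prod_def)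
    then show ?thesis using that by (simp add: RQ atLeastLessThanSuc_atLeastAtMost)
  qed
  have x_eq: "x k = (\<Sum>j=0..d. xt j * const_poly (Q $$ (j, k)))" if "k \<le> d" for k
  proof -
    have "(\<Sum>j=0..d. xt j * const_poly (Q $$ (j, k))) =
        (\<Sum>j=0..d. \<Sum>i=0..d. x i * const_poly (R $$ (i, j) * Q $$ (j, k)))"
      by (intro sum.cong refl) (simp add: assms(10) sum_distrib_right hom_mult mult.assoc)
    also have "\<dots> = (\<Sum>i=0..d. x i * const_poly (\<Sum>j=0..d. R $$ (i, j) * Q $$ (j, k)))"
      by (subst sum.swap) (simp only: hom_sum sum_distrib_left)
    also have "\<dots> = (\<Sum>i=0..d. if i = k then x i else 0)"
      using that by (intro sum.cong refl) (simp add: RQ_entry)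
    also have "\<dots> = x k" using that by simp
    finally show ?thesis by simp
  qed
  have xt_eq: "xt j = (\<Sum>i=0..d. x i * const_poly (\<theta>t * (pt i * U $$ (j, i))))" if "j \<le> d" for j
    unfolding assms(10)[OF that] using that by (intro sum.cong refl) (simp add: R)
  \<comment> \<open>Writing the entry \<open>(i, j)\<close> of \<open>U\<close> as entry
    \<open>(j, i)\<close> of its transpose gives this the same shape as
    \<open>xt_eq\<close>.\<close>
  have x_eq': "x j = (\<Sum>i=0..d. xt i * const_poly (\<theta> * (p i * transpose_mat U $$ (j, i))))"
    if "j \<le> d" for j
    unfolding x_eq[OF that] using that by (intro sum.cong refl) (simp add: Q dims)
  \<comment> \<open>Common form of both identities: \<open>(t, q, V, z, v)\<close> is
    \<open>(\<theta>t, pt, U, xt, x)\<close> for the first, and \<open>\<theta>\<close>,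
    \<open>p\<close>, the transpose of \<open>U\<close>, \<open>x\<close>, \<open>xt\<close> for the
    second.\<close>
  have scale: "const_poly (1 / t ^ N) * multi_power d z n =
      const_poly (fact N) * (\<Sum>m\<in>multi_indices d N.
        const_poly (krawtchouk d N V m n * (multi_power d q m / of_nat (multi_fact d m))) *
        multi_power d v m)"
    if t: "t \<noteq> 0" and n: "n \<in> multi_indices d N"
      and V: "\<And>j. j \<le> d \<Longrightarrow> V $$ (0, j) = 1" "\<And>j. j \<le> d \<Longrightarrow> V $$ (j, 0) = 1"
      and z: "\<And>j. j \<le> d \<Longrightarrow> z j = (\<Sum>i=0..d. v i * const_poly (t * (q i * V $$ (j, i))))"
    for t :: complex and z v :: "nat \<Rightarrow> cpoly" and q :: "nat \<Rightarrow> complex" and V n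
  proof -
    have "multi_power d z n = (\<Prod>j=0..d. (const_poly t *
        (\<Sum>i=0..d. const_poly (V $$ (j, i)) * (const_poly (q i) * v i))) ^ n j)"
      unfolding multi_power_def
    proof (intro prod.cong refl)
      fix j assume "j \<in> {0..d}"
      then have "z j = const_poly t * (\<Sum>i=0..d. const_poly (V $$ (j, i)) * (const_poly (q i) * v i))"
        by (simp add: z sum_distrib_left hom_mult ac_simps)
      then show "z j ^ n j = (const_poly t *
          (\<Sum>i=0..d. const_poly (V $$ (j, i)) * (const_poly (q i) * v i))) ^ n j"
        by simp
    qed
    \<comment> \<open>The exponents \<open>n j\<close> sum to \<open>N\<close>, so the scalars
      collect to \<open>t ^ N\<close>, which cancels the prefactor.\<close>
    also have "\<dots> = const_poly (t ^ N) *
        (\<Prod>j=0..d. (\<Sum>i=0..d. const_poly (V $$ (j, i)) * (const_poly (q i) * v i)) ^ n j)"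
      using n by (simp add: power_mult_distrib prod.distrib power_sum[symmetric] multi_indices_def hom_power)
    finally have "const_poly (1 / t ^ N) * multi_power d z n =
        (\<Prod>j=0..d. (\<Sum>i=0..d. const_poly (V $$ (j, i)) * (const_poly (q i) * v i)) ^ n j)"
      using t by (simp add: mult.assoc[symmetric] hom_mult[symmetric])
    also have "\<dots> = const_poly (fact N) * (\<Sum>m\<in>multi_indices d N.
        const_poly (krawtchouk d N V m n / of_nat (multi_fact d m)) *
        multi_power d (\<lambda>i. const_poly (q i) * v i) m)"
      using V n by (intro krawtchouk_generating_identity const_poly_field_algebra)
    finally have "const_poly (1 / t ^ N) * multi_power d z n = \<dots>" .
    moreover have "multi_power d (\<lambda>i. const_poly (q i) * v i) m =
        const_poly (multi_power d q m) * multi_power d v m" for m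
      by (simp add: multi_power_def power_mult_distrib prod.distrib hom_prod hom_power)
    ultimately show ?thesis
      by (simp add: mult.assoc[symmetric] hom_mult[symmetric])
  qed
  show ?thesis
  proof (intro conjI ballI)
    fix nt assume "nt \<in> multi_indices d N"
    then show "const_poly (1 / \<theta>t ^ N) * multi_power d xt nt =
        const_poly (fact N) * (\<Sum>n\<in>multi_indices d N.
          const_poly (krawtchouk d N U n nt * (multi_power d pt n / of_nat (multi_fact d n))) *
          multi_power d x n)"
      by (rule scale[OF tht _ U0 xt_eq])
  next
    fix n assume "n \<in> multi_indices d N"
    then have "const_poly (1 / \<theta> ^ N) * multi_power d x n =
        const_poly (fact N) * (\<Sum>nt\<in>multi_indices d N.
          const_poly (krawtchouk d N (transpose_mat U) nt n *
            (multi_power d p nt / of_nat (multi_fact d nt))) *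
          multi_power d xt nt)"
      using U0 by (intro scale[OF th(1) _ _ _ x_eq']) (simp_all add: dims)
    then show "const_poly (1 / \<theta> ^ N) * multi_power d x n =
        const_poly (fact N) * (\<Sum>nt\<in>multi_indices d N.
          const_poly (krawtchouk d N U n nt * (multi_power d p nt / of_nat (multi_fact d nt))) *
          multi_power d xt nt)"
      by (simp only: krawtchouk_transpose[OF carr(3)])
  qed
qed

end
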